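(* Suppose the distributed stochastic optimization problem (P) described in the context is feasible, i.e., there is at least one distributed algorithm with $\limsup_{t\to\infty}\overline{p}_k(t)\le c_k$ for all $k\in\{1,\dots,K\}$. Let $p_0^{opt}$ be the infimum of $\limsup_{t\to\infty}\overline{p}_0(t)$ over all such distributed algorithms. Then the linear program in the variables $(\theta_1,\dots,\theta_M)$ $$\text{Minimize } \sum_{m=1}^M\theta_m r_0^{(m)}\quad\text{subject to } \sum_{m=1}^M\theta_m r_k^{(m)}\le c_k\ \ \forall k\in\{1,\dots,K\},\quad \theta_m\ge 0\ \ \forall m\in\{1,\dots,M\},\quad \sum_{m=1}^M\theta_m=1$$ is feasible, and its optimal objective value equals $p_0^{opt}$. Furthermore, there exist probabilities $(\theta_1,\dots,\theta_M)$ that solve this linear program and satisfy $\theta_m>0$ for at most $K+1$ values of $m\in\{1,\dots,M\}$.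
   Context: Setting. There are $N$ users and discrete time slots $t\in\{0,1,2,\dots\}$. $\Omega=\Omega_1\times\cdots\times\Omega_N$ and $\mathcal{A}=\mathcal{A}_1\times\cdots\times\mathcal{A}_N$, where all $\Omega_i$ and $\mathcal{A}_i$ are finite nonempty sets. The random event vectors $\boldsymbol{\omega}(t)=(\omega_1(t),\dots,\omega_N(t))\in\Omega$ are i.i.d. over slots $t$ (entries within a slot may be correlated), with $\pi(\boldsymbol{\omega})=Pr[\boldsymbol{\omega}(t)=\boldsymbol{\omega}]$. On each slot an action vector $\boldsymbol{\alpha}(t)=(\alpha_1(t),\dots,\alpha_N(t))\in\mathcal{A}$ is chosen. $K$ is a non-negative integer, $\hat p_k:\mathcal{A}\times\Omega\to\mathbb{R}$ ($k=0,1,\dots,K$) are arbitrary functions, $p_k(t)=\hat p_k(\boldsymbol{\alpha}(t),\boldsymbol{\omega}(t))$, and $c_1,\dots,c_K$ are given real numbers. (Here $\hat p_0=-\hat u$ for a utility function $\hat u$.) For $t>0$, $\overline{p}_k(t)=\frac1t\sum_{\tau=0}^{t-1}\mathbb{E}[p_k(\tau)]$. Distributed algorithm. An algorithm for selecting $\boldsymbol{\alpha}(t)$ over slots is distributed if there are: an abstract set $\mathcal{X}$; a sequence of random elements $X(t)\in\mathcal{X}$ such that $\boldsymbol{\omega}(t)$ is independent of $X(t)$ for each $t\in\{0,1,2,\dots\}$; and deterministic functions $f_i:\Omega_i\times\mathcal{X}\to\mathcal{A}_i$, $i\in\{1,\dots,N\}$, such that $\alpha_i(t)=f_i(\omega_i(t),X(t))$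 for all $i$ and all $t$. The choice of $\mathcal{X}$, $X(t)$ and $f_i$ is part of the algorithm; $X(t)$ may depend on $t$, on past events and actions, and on extra randomness. Problem (P): minimize $\limsup_{t\to\infty}\overline{p}_0(t)$ over distributed algorithms, subject to $\limsup_{t\to\infty}\overline{p}_k(t)\le c_k$ for all $k\in\{1,\dots,K\}$. Pure strategies. A pure strategy is a function $\boldsymbol{g}(\boldsymbol{\omega})=(g_1(\omega_1),\dots,g_N(\omega_N))$ with $g_i:\Omega_i\to\mathcal{A}_i$. There are $M=\prod_{i=1}^N|\mathcal{A}_i|^{|\Omega_i|}$ of them, enumerated $\boldsymbol{g}^{(1)},\dots,\boldsymbol{g}^{(M)}$. For $m\in\{1,\dots,M\}$ and $k\in\{0,\dots,K\}$, $r_k^{(m)}=\sum_{\boldsymbol{\omega}\in\Omega}\pi(\boldsymbol{\omega})\hat p_k(\boldsymbol{g}^{(m)}(\boldsymbol{\omega}),\boldsymbol{\omega})$. *)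

theory Defs
  imports "HOL-Probability.Probability"
begin

text \<open>
  Users are the indices \<open>1, \<dots>, N\<close>. The sets \<open>Om i\<close> and \<open>A i\<close> live in common types \<open>'e\<close> and \<open>'a\<close>;
  event and action vectors are extensional functions on \<open>{1..N}\<close>. The underlying probability space
  is \<open>P\<close>, with sample points of type \<open>'w\<close>.
\<close>

abbreviation vectors :: "nat \<Rightarrow> (nat \<Rightarrow> 'b set) \<Rightarrow> (nat \<Rightarrow> 'b) set" where
  "vectors N S \<equiv> Pi\<^sub>E {1..N} S"

definition iid_events ::
  "'w measure \<Rightarrow> nat \<Rightarrow> (nat \<Rightarrow> 'e set) \<Rightarrow> (nat \<Rightarrow> 'w \<Rightarrow> nat \<Rightarrow> 'e) \<Rightarrow> ((nat \<Rightarrow> 'e) \<Rightarrow> real) \<Rightarrow> bool"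
where
  "iid_events P N Om \<omega> \<pi> \<longleftrightarrow>
     prob_space.indep_vars P (\<lambda>_. count_space (vectors N Om)) \<omega> UNIV \<and>
     (\<forall>t. \<forall>e\<in>vectors N Om. measure P {z \<in> space P. \<omega> t z = e} = \<pi> e)"

text \<open>
  The abstract set of the definition of a distributed algorithm is the space of the measure
  \<open>aux_space\<close> (only its sigma-algebra matters), \<open>aux t\<close> is the random element \<open>X(t)\<close>, and
  \<open>decide i\<close> is the function \<open>f\<^sub>i\<close>. The type \<open>'x\<close> is the universe from which the abstract set is
  drawn; a set of algorithms ranges over all measurable spaces carried by subsets of \<open>'x\<close>. A
  universe with fewer elements than there are pure strategies would exclude algorithms, so
  \<open>'x\<close> is to be infinite (and is otherwise arbitrary).
\<close>

record ('w, 'e, 'a, 'x) algorithm =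
  aux_space :: "'x measure"
  aux :: "nat \<Rightarrow> 'w \<Rightarrow> 'x"
  decide :: "nat \<Rightarrow> 'e \<Rightarrow> 'x \<Rightarrow> 'a"

text \<open>
  Independence is phrased with \<^const>\<open>prob_space.indep_set\<close> on the generated sigma-algebras because
  \<^const>\<open>prob_space.indep_var\<close> forces both variables to take values in the same type.
  Measurability of \<open>decide i e\<close> is what makes the actions random elements.
\<close>

definition distributed ::
  "'w measure \<Rightarrow> nat \<Rightarrow> (nat \<Rightarrow> 'e set) \<Rightarrow> (nat \<Rightarrow> 'a set) \<Rightarrow> (nat \<Rightarrow> 'w \<Rightarrow> nat \<Rightarrow> 'e) \<Rightarrow>
   ('w, 'e, 'a, 'x) algorithm \<Rightarrow> bool"
where
  "distributed P N Om A \<omega> D \<longleftrightarrow>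
     (\<forall>t. aux D t \<in> measurable P (aux_space D)) \<and>
     (\<forall>t. prob_space.indep_set P
            {\<omega> t -` B \<inter> space P | B. B \<in> sets (count_space (vectors N Om))}
            {aux D t -` C \<inter> space P | C. C \<in> sets (aux_space D)}) \<and>
     (\<forall>i\<in>{1..N}. \<forall>e\<in>Om i. decide D i e \<in> measurable (aux_space D) (count_space (A i)))"

definition action ::
  "nat \<Rightarrow> (nat \<Rightarrow> 'w \<Rightarrow> nat \<Rightarrow> 'e) \<Rightarrow> ('w, 'e, 'a, 'x) algorithm \<Rightarrow> nat \<Rightarrow> 'w \<Rightarrow> nat \<Rightarrow> 'a"
where
  "action N \<omega> D t z = (\<lambda>i\<in>{1..N}. decide D i (\<omega> t z i) (aux D t z))"

definition avg_penalty ::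
  "'w measure \<Rightarrow> nat \<Rightarrow> (nat \<Rightarrow> 'w \<Rightarrow> nat \<Rightarrow> 'e) \<Rightarrow> ((nat \<Rightarrow> 'a) \<Rightarrow> (nat \<Rightarrow> 'e) \<Rightarrow> real) \<Rightarrow>
   ('w, 'e, 'a, 'x) algorithm \<Rightarrow> nat \<Rightarrow> real"
where
  "avg_penalty P N \<omega> ph D t =
     (1 / real t) * (\<Sum>\<tau><t. integral\<^sup>L P (\<lambda>z. ph (action N \<omega> D \<tau> z) (\<omega> \<tau> z)))"

definition feasible_algorithms ::
  "'w measure \<Rightarrow> nat \<Rightarrow> (nat \<Rightarrow> 'e set) \<Rightarrow> (nat \<Rightarrow> 'a set) \<Rightarrow> (nat \<Rightarrow> 'w \<Rightarrow> nat \<Rightarrow> 'e) \<Rightarrow> nat \<Rightarrow>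
   (nat \<Rightarrow> (nat \<Rightarrow> 'a) \<Rightarrow> (nat \<Rightarrow> 'e) \<Rightarrow> real) \<Rightarrow> (nat \<Rightarrow> real) \<Rightarrow> ('w, 'e, 'a, 'x) algorithm set"
where
  "feasible_algorithms P N Om A \<omega> K p c =
     {D. distributed P N Om A \<omega> D \<and>
         (\<forall>k\<in>{1..K}. limsup (\<lambda>t. ereal (avg_penalty P N \<omega> (p k) D t)) \<le> ereal (c k))}"

definition pure_strategies ::
  "nat \<Rightarrow> (nat \<Rightarrow> 'e set) \<Rightarrow> (nat \<Rightarrow> 'a set) \<Rightarrow> ((nat \<Rightarrow> 'e) \<Rightarrow> nat \<Rightarrow> 'a) set"
where
  "pure_strategies N Om A =
     (\<lambda>h. \<lambda>e\<in>vectors N Om. \<lambda>i\<in>{1..N}. h i (e i)) ` (\<Pi>\<^sub>E i\<in>{1..N}. Om i \<rightarrow>\<^sub>E A i)"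

definition num_pure :: "nat \<Rightarrow> (nat \<Rightarrow> 'e set) \<Rightarrow> (nat \<Rightarrow> 'a set) \<Rightarrow> nat" where
  "num_pure N Om A = (\<Prod>i=1..N. card (A i) ^ card (Om i))"

lemma card_pure_strategies:
  assumes "\<And>i. i \<in> {1..N} \<Longrightarrow> finite (Om i) \<and> Om i \<noteq> {}"
  shows "card (pure_strategies N Om A) = num_pure N Om A"
proof -
  let ?F = "\<lambda>h. \<lambda>e\<in>vectors N Om. \<lambda>i\<in>{1..N}. h i (e i)"
  have "inj_on ?F (\<Pi>\<^sub>E i\<in>{1..N}. Om i \<rightarrow>\<^sub>E A i)"
  proof (rule inj_onI)
    fix h h' :: "nat \<Rightarrow> 'a \<Rightarrow> 'b"
    assume h: "h \<in> (\<Pi>\<^sub>E i\<in>{1..N}. Om i \<rightarrow>\<^sub>E A i)" and h': "h' \<in> (\<Pi>\<^sub>E i\<in>{1..N}. Om i \<rightarrow>\<^sub>E A i)"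
      and eq: "?F h = ?F h'"
    show "h = h'"
    proof (rule PiE_ext[OF h h'])
      fix i assume i: "i \<in> {1..N}"
      show "h i = h' i"
      proof (rule PiE_ext)
        show "h i \<in> Om i \<rightarrow>\<^sub>E A i" "h' i \<in> Om i \<rightarrow>\<^sub>E A i"
          using PiE_mem[OF h i] PiE_mem[OF h' i] by auto
        fix x assume x: "x \<in> Om i"
        define e where "e = (\<lambda>j\<in>{1..N}. if j = i then x else (SOME y. y \<in> Om j))"
        have e: "e \<in> vectors N Om"
          using assms x by (auto simp: e_def some_in_eq)
        have "?F h e i = ?F h' e i"
          using eq by simp
        with e i show "h i x = h' i x"
          by (simp add: e_def)
      qed
    qed
  qed
  then have "card (pure_strategies N Om A) = card (\<Pi>\<^sub>E i\<in>{1..N}. Om i \<rightarrow>\<^sub>E A i)"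
    unfolding pure_strategies_def by (rule card_image)
  also have "\<dots> = num_pure N Om A"
    using assms by (simp add: card_PiE num_pure_def)
  finally show ?thesis .
qed

definition strategy_penalty ::
  "nat \<Rightarrow> (nat \<Rightarrow> 'e set) \<Rightarrow> ((nat \<Rightarrow> 'e) \<Rightarrow> real) \<Rightarrow> ((nat \<Rightarrow> 'a) \<Rightarrow> (nat \<Rightarrow> 'e) \<Rightarrow> real) \<Rightarrow>
   ((nat \<Rightarrow> 'e) \<Rightarrow> nat \<Rightarrow> 'a) \<Rightarrow> real"
where
  "strategy_penalty N Om \<pi> ph g = (\<Sum>e\<in>vectors N Om. \<pi> e * ph (g e) e)"

text \<open>
  The linear program: \<open>r k m\<close> is \<open>r\<^sub>k\<^sup>(\<^sup>m\<^sup>)\<close>, and only the values of \<open>\<theta>\<close> on \<open>{1..L}\<close> are relevant.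
\<close>

definition lp_objective :: "nat \<Rightarrow> (nat \<Rightarrow> nat \<Rightarrow> real) \<Rightarrow> (nat \<Rightarrow> real) \<Rightarrow> real" where
  "lp_objective L r \<theta> = (\<Sum>m=1..L. \<theta> m * r 0 m)"

definition lp_feasible ::
  "nat \<Rightarrow> nat \<Rightarrow> (nat \<Rightarrow> nat \<Rightarrow> real) \<Rightarrow> (nat \<Rightarrow> real) \<Rightarrow> (nat \<Rightarrow> real) set"
where
  "lp_feasible L K r c =
     {\<theta>. (\<forall>k\<in>{1..K}. (\<Sum>m=1..L. \<theta> m * r k m) \<le> c k) \<and>
         (\<forall>m\<in>{1..L}. \<theta> m \<ge> 0) \<and> (\<Sum>m=1..L. \<theta> m) = 1}"

definition lp_value ::
  "nat \<Rightarrow> nat \<Rightarrow> (nat \<Rightarrow> nat \<Rightarrow> real) \<Rightarrow> (nat \<Rightarrow> real) \<Rightarrow> ereal"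
where
  "lp_value L K r c = (INF \<theta>\<in>lp_feasible L K r c. ereal (lp_objective L r \<theta>))"

definition lp_solution ::
  "nat \<Rightarrow> nat \<Rightarrow> (nat \<Rightarrow> nat \<Rightarrow> real) \<Rightarrow> (nat \<Rightarrow> real) \<Rightarrow> (nat \<Rightarrow> real) \<Rightarrow> bool"
where
  "lp_solution L K r c \<theta> \<longleftrightarrow>
     \<theta> \<in> lp_feasible L K r c \<and>
     (\<forall>\<theta>'\<in>lp_feasible L K r c. lp_objective L r \<theta> \<le> lp_objective L r \<theta>')"

end

theory Submission
  imports Defs
begin

text \<open>
  At any time \<open>t\<close>, the value of \<open>X(t)\<close> fixes one function from events to actions for each user,
  so it selects a pure strategy. Since \<open>X(t)\<close> is independent of \<open>\<omega>(t)\<close>, the expected penalties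
  of the slot are the average of the penalty vectors \<open>(r\<^sub>0\<^sup>(\<^sup>m\<^sup>), \<dots>, r\<^sub>K\<^sup>(\<^sup>m\<^sup>))\<close>, weighted by the
  probabilities with which the strategies are selected (\<open>expected_penalty\<close>). Time averages of
  expected penalties are therefore again such convex combinations, now with time-averaged weights.
  The weights live in a compact simplex; along a convergent subsequence their limit is a feasible
  point of the linear program, with an objective no worse than the limit superior achieved by the
  algorithm (\<open>distributed_converse\<close>, from \<open>lp_limit_point\<close>).

  Conversely, the weights \<open>\<theta>\<close> of a feasible point are realised without any randomness: the
  common variable \<open>X(t)\<close> is a deterministic schedule that uses strategy \<open>m\<close> with limiting
  frequency \<open>\<theta>\<^sub>m\<close> (\<open>time_sharing_sequence\<close>). A deterministic \<open>X(t)\<close> is independent of everything,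
  so this works on every probability space, also on one that supports no random choice besides the
  events (\<open>distributed_achievability\<close>). Hence the two infima agree.

  An optimal point exists by compactness (\<open>lp_optimum_exists\<close>). If it has more than \<open>K + 1\<close>
  positive coordinates, there is a nonzero direction supported on them that preserves the total
  mass and the \<open>K\<close> constraint values. One of its two orientations does not increase the
  objective, and following it until a coordinate vanishes shrinks the support
  (\<open>lp_support_reduction\<close>). Counting the equations this way gives \<open>K + 1\<close>, where a Caratheodory
  argument for all \<open>K + 1\<close> penalties would give \<open>K + 2\<close>.
\<close>

section \<open>Sparse solutions of the linear program\<close>

text \<open>
  A homogeneous linear system with more unknowns than equations, solved by eliminating one unknown
  with the last equation.
\<close>

lemma nontrivial_kernel_vector:
  fixes a :: "nat \<Rightarrow> 'i \<Rightarrow> real"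
  assumes "finite S" and "n < card S"
  shows "\<exists>d. (\<exists>m\<in>S. d m \<noteq> 0) \<and> (\<forall>k<n. (\<Sum>m\<in>S. d m * a k m) = 0)"
  using assms
proof (induction n arbitrary: a S)
  case 0
  then obtain m where "m \<in> S" by fastforce
  then show ?case by (intro exI[of _ "\<lambda>_. 1"]) auto
next
  case (Suc n)
  show ?case
  proof (cases "\<forall>m\<in>S. a n m = 0")
    case True
    obtain d where "\<exists>m\<in>S. d m \<noteq> 0" "\<forall>k<n. (\<Sum>m\<in>S. d m * a k m) = 0"
      using Suc.IH[of S a] Suc.prems by auto
    with True show ?thesis by (intro exI[of _ d]) (auto simp: less_Suc_eq)
  next
    case False
    then obtain m0 where m0: "m0 \<in> S" "a n m0 \<noteq> 0" by blast
    let ?S = "S - {m0}"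
    have "finite ?S" "n < card ?S" using Suc.prems m0 by auto
    from Suc.IH[OF this, of "\<lambda>k m. a k m - a k m0 * a n m / a n m0"]
    obtain d where d: "\<exists>m\<in>?S. d m \<noteq> 0"
      and eq: "\<And>k. k < n \<Longrightarrow> (\<Sum>m\<in>?S. d m * (a k m - a k m0 * a n m / a n m0)) = 0"
      by blast
    \<comment> \<open>The coordinate at the pivot is solved from the last equation.\<close>
    define q where "q = (\<Sum>m\<in>?S. d m * a n m) / a n m0"
    define d' where "d' = d(m0 := - q)"
    have split: "(\<Sum>m\<in>S. d' m * a k m) = - q * a k m0 + (\<Sum>m\<in>?S. d m * a k m)" for k
    proof -
      have "(\<Sum>m\<in>S. d' m * a k m) = d' m0 * a k m0 + (\<Sum>m\<in>?S. d' m * a k m)"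
        using Suc.prems m0 by (simp add: sum.remove)
      also have "(\<Sum>m\<in>?S. d' m * a k m) = (\<Sum>m\<in>?S. d m * a k m)"
        by (rule sum.cong) (auto simp: d'_def)
      finally show ?thesis by (simp add: d'_def)
    qed
    have "(\<Sum>m\<in>S. d' m * a k m) = 0" if "k < Suc n" for k
    proof (cases "k = n")
      case True
      then show ?thesis unfolding split using m0 by (simp add: q_def)
    next
      case False
      with that have "k < n" by simp
      have "(\<Sum>m\<in>?S. d m * (a k m - a k m0 * a n m / a n m0))
          = (\<Sum>m\<in>?S. d m * a k m) - (\<Sum>m\<in>?S. (d m * a n m) * (a k m0 / a n m0))"
        unfolding sum_subtractf[symmetric] by (rule sum.cong) (auto simp: algebra_simps)
      also have "(\<Sum>m\<in>?S. (d m * a n m) * (a k m0 / a n m0)) = q * a k m0"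
        unfolding sum_distrib_right[symmetric] q_def by simp
      finally show ?thesis unfolding split using eq[OF \<open>k < n\<close>] by simp
    qed
    moreover have "\<exists>m\<in>S. d' m \<noteq> 0" using d by (auto simp: d'_def)
    ultimately show ?thesis by blast
  qed
qed

text \<open>
  There are \<open>K + 1\<close> equations to respect, one for the total mass and one for each constraint
  value, so a larger support leaves a direction to move in. Its coordinates sum to zero, so some
  coordinate decreases and the move is stopped by a vanishing coordinate.
\<close>

lemma lp_support_reduction:
  assumes "\<theta> \<in> lp_feasible L K r c" and "K + 1 < card {m \<in> {1..L}. \<theta> m > 0}"
  shows "\<exists>\<theta>'\<in>lp_feasible L K r c. lp_objective L r \<theta>' \<le> lp_objective L r \<theta> \<and>
           card {m \<in> {1..L}. \<theta>' m > 0} < card {m \<in> {1..L}. \<theta> m > 0}"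
proof -
  let ?S = "{m \<in> {1..L}. \<theta> m > 0}"
  have feas: "\<And>k. k \<in> {1..K} \<Longrightarrow> (\<Sum>m=1..L. \<theta> m * r k m) \<le> c k"
    "\<And>m. m \<in> {1..L} \<Longrightarrow> \<theta> m \<ge> 0" "(\<Sum>m=1..L. \<theta> m) = 1"
    using assms(1) unfolding lp_feasible_def by auto
  \<comment> \<open>Index 0 carries the normalisation constraint.\<close>
  obtain d where d: "\<exists>m\<in>?S. d m \<noteq> 0"
    and dk: "\<And>k. k < K + 1 \<Longrightarrow> (\<Sum>m\<in>?S. d m * (if k = 0 then 1 else r k m)) = 0"
    using nontrivial_kernel_vector[of ?S "K + 1" "\<lambda>k m. if k = 0 then 1 else r k m"] assms(2)
    by auto
  \<comment> \<open>The sign orients the direction so that the objective does not increase.\<close>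
  define s where "s = (if (\<Sum>m\<in>?S. d m * r 0 m) \<le> 0 then 1 else - 1 :: real)"
  define v where "v m = (if m \<in> ?S then s * d m else 0)" for m
  have v_sum: "(\<Sum>m=1..L. v m * f m) = s * (\<Sum>m\<in>?S. d m * f m)" for f
  proof -
    have "(\<Sum>m=1..L. v m * f m) = (\<Sum>m\<in>?S. v m * f m)"
      by (rule sum.mono_neutral_right) (auto simp: v_def)
    also have "\<dots> = s * (\<Sum>m\<in>?S. d m * f m)"
      unfolding sum_distrib_left by (rule sum.cong) (auto simp: v_def)
    finally show ?thesis .
  qed
  have v1: "(\<Sum>m=1..L. v m) = 0"
    using v_sum[of "\<lambda>_. 1"] dk[of 0] by simp
  have vk: "(\<Sum>m=1..L. v m * r k m) = 0" if "k \<in> {1..K}" for k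
    using v_sum[of "r k"] dk[of k] that by simp
  have v0: "(\<Sum>m=1..L. v m * r 0 m) \<le> 0"
    using v_sum[of "r 0"] by (auto simp: s_def)
  have vS: "v m = 0" if "m \<notin> ?S" for m using that by (auto simp: v_def)
  define T where "T = {m \<in> {1..L}. v m < 0}"
  have "T \<noteq> {}"
  proof
    assume "T = {}"
    then have "\<And>m. m \<in> {1..L} \<Longrightarrow> v m \<ge> 0" unfolding T_def by fastforce
    then have "\<forall>m\<in>{1..L}. v m = 0"
      using v1 by (subst (asm) sum_nonneg_eq_0_iff) auto
    moreover obtain m where "m \<in> ?S" "d m \<noteq> 0" using d by blast
    ultimately show False by (auto simp: v_def s_def split: if_splits)
  qed
  have "finite T" by (simp add: T_def)
  \<comment> \<open>The step length is the largest one that keeps all coordinates nonnegative.\<close>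
  define \<epsilon> where "\<epsilon> = Min ((\<lambda>m. \<theta> m / (- v m)) ` T)"
  obtain m0 where m0: "m0 \<in> T" "\<epsilon> = \<theta> m0 / (- v m0)"
    using Min_in[of "(\<lambda>m. \<theta> m / (- v m)) ` T", folded \<epsilon>_def] \<open>finite T\<close> \<open>T \<noteq> {}\<close> by blast
  have \<epsilon>_le: "\<epsilon> \<le> \<theta> m / (- v m)" if "m \<in> T" for m
    using that \<open>finite T\<close> unfolding \<epsilon>_def by simp
  have \<epsilon>0: "\<epsilon> \<ge> 0"
    using m0 feas(2)[of m0] by (auto simp: T_def divide_nonneg_neg)
  define \<theta>' where "\<theta>' m = \<theta> m + \<epsilon> * v m" for m
  have lin: "(\<Sum>m=1..L. \<theta>' m * f m) = (\<Sum>m=1..L. \<theta> m * f m) + \<epsilon> * (\<Sum>m=1..L. v m * f m)" for f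
    by (simp add: \<theta>'_def algebra_simps sum.distrib sum_distrib_left)
  have nonneg: "\<theta>' m \<ge> 0" if m: "m \<in> {1..L}" for m
  proof (cases "m \<in> T")
    case True
    then have "v m < 0" by (simp add: T_def)
    then show ?thesis using \<epsilon>_le[OF True] by (simp add: \<theta>'_def field_simps)
  next
    case False
    then show ?thesis using m feas(2)[OF m] \<epsilon>0 by (simp add: \<theta>'_def T_def)
  qed
  have "\<theta>' \<in> lp_feasible L K r c"
    unfolding lp_feasible_def
    using lin vk feas(1) nonneg lin[of "\<lambda>_. 1"] v1 feas(3) by auto
  moreover have "lp_objective L r \<theta>' \<le> lp_objective L r \<theta>"
    unfolding lp_objective_def lin using v0 \<epsilon>0 by (simp add: mult_nonneg_nonpos)
  moreover have "{m \<in> {1..L}. \<theta>' m > 0} \<subset> ?S"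
  proof (rule psubsetI)
    show "{m \<in> {1..L}. \<theta>' m > 0} \<subseteq> ?S"
      using vS unfolding \<theta>'_def by fastforce
    have "\<theta>' m0 = 0" using m0 by (simp add: \<theta>'_def T_def)
    moreover have "m0 \<in> ?S" using m0 vS[of m0] by (auto simp: T_def)
    ultimately have "m0 \<in> ?S - {m \<in> {1..L}. \<theta>' m > 0}" by simp
    then show "{m \<in> {1..L}. \<theta>' m > 0} \<noteq> ?S" by blast
  qed
  then have "card {m \<in> {1..L}. \<theta>' m > 0} < card ?S"
    by (intro psubset_card_mono) auto
  ultimately show ?thesis by blast
qed

lemma lp_sparse_improvement:
  assumes "\<theta> \<in> lp_feasible L K r c"
  shows "\<exists>\<theta>'\<in>lp_feasible L K r c. lp_objective L r \<theta>' \<le> lp_objective L r \<theta> \<and>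
           card {m \<in> {1..L}. \<theta>' m > 0} \<le> K + 1"
  using assms
proof (induction "card {m \<in> {1..L}. \<theta> m > 0}" arbitrary: \<theta> rule: less_induct)
  case less
  show ?case
  proof (cases "card {m \<in> {1..L}. \<theta> m > 0} \<le> K + 1")
    case True
    with less.prems show ?thesis by blast
  next
    case False
    then have "K + 1 < card {m \<in> {1..L}. \<theta> m > 0}" by simp
    from lp_support_reduction[OF less.prems this]
    obtain \<theta>1 where "\<theta>1 \<in> lp_feasible L K r c" "lp_objective L r \<theta>1 \<le> lp_objective L r \<theta>"
      "card {m \<in> {1..L}. \<theta>1 m > 0} < card {m \<in> {1..L}. \<theta> m > 0}" by blast
    with less.hyps[of \<theta>1] show ?thesis by (meson order_trans)
  qed
qed

section \<open>Limit points and optimality\<close>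

lemma bounded_pointwise_convergent_subseq:
  fixes x :: "nat \<Rightarrow> 'i \<Rightarrow> real"
  assumes "finite I" and "\<And>i. i \<in> I \<Longrightarrow> bounded (range (\<lambda>t. x t i))"
  shows "\<exists>l s. strict_mono (s :: nat \<Rightarrow> nat) \<and> (\<forall>i\<in>I. (\<lambda>t. x (s t) i) \<longlonglongrightarrow> l i)"
  using assms
proof (induction I rule: finite_induct)
  case empty
  show ?case by (auto intro: exI[of _ id] strict_mono_id)
next
  case (insert j I)
  then obtain l s where s: "strict_mono (s :: nat \<Rightarrow> nat)" "\<forall>i\<in>I. (\<lambda>t. x (s t) i) \<longlonglongrightarrow> l i"
    by blast
  have "bounded (range (\<lambda>t. x (s t) j))"
    using insert.prems[of j] by (rule bounded_subset) auto
  then obtain lj s' where s': "strict_mono (s' :: nat \<Rightarrow> nat)" "((\<lambda>t. x (s t) j) \<circ> s') \<longlonglongrightarrow> lj"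
    using bounded_imp_convergent_subsequence by blast
  have "(\<lambda>t. x ((s \<circ> s') t) i) \<longlonglongrightarrow> (l(j := lj)) i" if "i \<in> insert j I" for i
  proof (cases "i = j")
    case True
    with s' show ?thesis by (simp add: o_def)
  next
    case False
    with that s have "(\<lambda>t. x (s t) i) \<longlonglongrightarrow> l i" by simp
    from LIMSEQ_subseq_LIMSEQ[OF this s'(1)] False show ?thesis by (simp add: o_def)
  qed
  moreover have "strict_mono (s \<circ> s')" using s s' by (simp add: strict_mono_o)
  ultimately show ?case by blast
qed

text \<open>
  Compactness of the simplex in the form in which it is used twice: for minimising sequences of the
  linear program, where all points are feasible, and for time averages of an algorithm, where the
  constraints hold only in the limit superior.
\<close>

lemma lp_limit_point:
  assumes nonneg: "\<And>t m. m \<in> {1..L} \<Longrightarrow> \<theta> t m \<ge> 0"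
    and sum1: "\<And>t. (\<Sum>m=1..L. \<theta> t m) = 1"
    and lims: "\<And>k. k \<in> {1..K} \<Longrightarrow> limsup (\<lambda>t. ereal (\<Sum>m=1..L. \<theta> t m * r k m)) \<le> ereal (c k)"
  shows "\<exists>\<theta>'\<in>lp_feasible L K r c.
           ereal (lp_objective L r \<theta>') \<le> limsup (\<lambda>t. ereal (lp_objective L r (\<theta> t)))"
proof -
  have "bounded (range (\<lambda>t. \<theta> t m))" if m: "m \<in> {1..L}" for m
  proof (rule boundedI)
    fix y assume "y \<in> range (\<lambda>t. \<theta> t m)"
    then obtain t where "y = \<theta> t m" by blast
    moreover have "\<theta> t m \<le> (\<Sum>m=1..L. \<theta> t m)"
      using m nonneg by (intro member_le_sum) auto
    ultimately show "norm y \<le> 1" using sum1[of t] nonneg[OF m, of t] by simp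
  qed
  then obtain l s where s: "strict_mono (s :: nat \<Rightarrow> nat)"
    and l: "\<And>m. m \<in> {1..L} \<Longrightarrow> (\<lambda>t. \<theta> (s t) m) \<longlonglongrightarrow> l m"
    using bounded_pointwise_convergent_subseq[of "{1..L}" \<theta>] by blast
  have conv: "(\<lambda>t. \<Sum>m=1..L. \<theta> (s t) m * f m) \<longlonglongrightarrow> (\<Sum>m=1..L. l m * f m)" for f
    by (intro tendsto_intros l)
  have le: "ereal (\<Sum>m=1..L. l m * f m) \<le> limsup (\<lambda>t. ereal (\<Sum>m=1..L. \<theta> t m * f m))" for f
  proof -
    have "ereal (\<Sum>m=1..L. l m * f m)
        = limsup ((\<lambda>t. ereal (\<Sum>m=1..L. \<theta> t m * f m)) \<circ> s)"
      using conv[of f] by (intro lim_imp_Limsup[symmetric]) (auto simp: o_def)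
    also have "\<dots> \<le> limsup (\<lambda>t. ereal (\<Sum>m=1..L. \<theta> t m * f m))"
      by (rule limsup_subseq_mono[OF s])
    finally show ?thesis .
  qed
  have "l m \<ge> 0" if "m \<in> {1..L}" for m
    using LIMSEQ_le_const[OF l[OF that]] nonneg[OF that] by blast
  moreover have "(\<Sum>m=1..L. l m) = 1"
    using conv[of "\<lambda>_. 1"] sum1 by (simp add: LIMSEQ_const_iff)
  moreover have "(\<Sum>m=1..L. l m * r k m) \<le> c k" if "k \<in> {1..K}" for k
    using order_trans[OF le[of "r k"] lims[OF that]] by simp
  ultimately have "l \<in> lp_feasible L K r c" unfolding lp_feasible_def by blast
  with le[of "r 0"] show ?thesis unfolding lp_objective_def by blast
qed

lemma lp_optimum_exists:
  assumes "lp_feasible L K r c \<noteq> {}"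
  shows "\<exists>\<theta>. lp_solution L K r c \<theta>"
proof -
  let ?obj = "\<lambda>\<theta>. ereal (lp_objective L r \<theta>)"
  let ?F = "lp_feasible L K r c"
  obtain y :: "nat \<Rightarrow> ereal" where y: "\<And>n. y n \<in> ?obj ` ?F" "y \<longlonglongrightarrow> Inf (?obj ` ?F)"
    using Inf_as_limit[of "?obj ` ?F"] assms by auto
  then have "\<forall>n. \<exists>\<theta>\<in>?F. y n = ?obj \<theta>" by blast
  then obtain \<theta> where \<theta>: "\<And>n. \<theta> n \<in> ?F" and y_eq: "\<And>n. y n = ?obj (\<theta> n)" by metis
  have "\<exists>\<theta>'\<in>?F. ?obj \<theta>' \<le> limsup (\<lambda>n. ?obj (\<theta> n))"
  proof (rule lp_limit_point)
    fix k assume "k \<in> {1..K}"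
    then show "limsup (\<lambda>n. ereal (\<Sum>m=1..L. \<theta> n m * r k m)) \<le> ereal (c k)"
      using \<theta> by (intro Limsup_bounded) (auto simp: lp_feasible_def)
  qed (use \<theta> in \<open>auto simp: lp_feasible_def\<close>)
  then obtain \<theta>' where \<theta>': "\<theta>' \<in> ?F" "?obj \<theta>' \<le> limsup (\<lambda>n. ?obj (\<theta> n))" by blast
  have "limsup (\<lambda>n. ?obj (\<theta> n)) = Inf (?obj ` ?F)"
    using y(2) unfolding y_eq by (intro lim_imp_Limsup) simp_all
  then have "?obj \<theta>' \<le> ?obj \<theta>2" if "\<theta>2 \<in> ?F" for \<theta>2
    using \<theta>'(2) INF_lower[OF that, of ?obj] by (metis order_trans)
  with \<theta>'(1) show ?thesis unfolding lp_solution_def by auto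
qed

section \<open>Deterministic time sharing\<close>

text \<open>
  The schedule is greedy. Let \<open>S\<^sub>n j\<close> be the number of uses of \<open>j\<close> before time \<open>n\<close> minus the target
  \<open>n \<theta>\<^sub>j\<close>. The next choice \<open>m\<close> is an index whose excess \<open>S\<^sub>n m\<close> is at most the \<open>\<theta>\<close>-weighted average
  excess. Then the increment has a nonpositive inner product with \<open>S\<^sub>n\<close>, so the squared norm
  of \<open>S\<^sub>n\<close> grows by at most the squared norm of the increment, which is at most 2. Hence
  \<open>S\<^sub>n j\<close> is of order \<open>\<surd>n\<close>, and the frequencies converge to \<open>\<theta>\<close>.
\<close>

lemma time_sharing_sequence:
  fixes \<theta> :: "'i \<Rightarrow> real"
  assumes fin: "finite I" and nonneg: "\<And>j. j \<in> I \<Longrightarrow> \<theta> j \<ge> 0" and sum1: "(\<Sum>j\<in>I. \<theta> j) = 1"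
  shows "\<exists>\<sigma>. (\<forall>t. \<sigma> t \<in> I) \<and>
           (\<forall>f. (\<lambda>t. (1 / real t) * (\<Sum>\<tau><t. f (\<sigma> \<tau>))) \<longlonglongrightarrow> (\<Sum>j\<in>I. \<theta> j * f j))"
proof -
  \<comment> \<open>The schedule is recovered from the sequence of excess vectors, built step by step.\<close>
  have "\<exists>S. \<forall>n. (\<Sum>j\<in>I. (S n j)\<^sup>2) \<le> 2 * real n \<and>
          (\<exists>m\<in>I. \<forall>j\<in>I. S (Suc n) j = S n j + of_bool (j = m) - \<theta> j)"
  proof (rule dependent_nat_choice)
    show "\<exists>v. (\<Sum>j\<in>I. (v j)\<^sup>2) \<le> 2 * real 0" by (intro exI[of _ "\<lambda>_. 0"]) simp
  next
    fix v n assume v: "(\<Sum>j\<in>I. (v j)\<^sup>2) \<le> 2 * real n"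
    define \<mu> where "\<mu> = (\<Sum>j\<in>I. \<theta> j * v j)"
    \<comment> \<open>Some coordinate is at most the weighted average of all of them.\<close>
    obtain m where m: "m \<in> I" "v m \<le> \<mu>"
    proof (rule ccontr)
      assume "\<not> thesis"
      with that have gt: "\<And>j. j \<in> I \<Longrightarrow> \<mu> < v j" by force
      have "\<exists>j\<in>I. \<theta> j > 0"
      proof (rule ccontr)
        assume "\<not> ?thesis"
        then have "(\<Sum>j\<in>I. \<theta> j) \<le> 0" by (intro sum_nonpos) force
        with sum1 show False by simp
      qed
      then obtain i where "i \<in> I" "\<theta> i * \<mu> < \<theta> i * v i" using gt by auto
      then have "(\<Sum>j\<in>I. \<theta> j * \<mu>) < (\<Sum>j\<in>I. \<theta> j * v j)"
        using fin nonneg gt by (intro sum_strict_mono_ex1) (auto intro: mult_left_mono less_imp_le)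
      then show False using sum1 by (simp add: \<mu>_def[symmetric] sum_distrib_right[symmetric])
    qed
    define w where "w j = v j + of_bool (j = m) - \<theta> j" for j
    have theta_le1: "\<theta> j \<le> 1" if "j \<in> I" for j
      using member_le_sum[of j I \<theta>] that fin nonneg sum1 by auto
    have "(\<Sum>j\<in>I. (w j)\<^sup>2) = (\<Sum>j\<in>I. (v j)\<^sup>2) + 2 * (\<Sum>j\<in>I. v j * (of_bool (j = m) - \<theta> j))
            + (\<Sum>j\<in>I. (of_bool (j = m) - \<theta> j)\<^sup>2)"
      unfolding w_def sum_distrib_left sum.distrib[symmetric]
      by (rule sum.cong) (auto simp: power2_eq_square algebra_simps)
    also have "(\<Sum>j\<in>I. v j * (of_bool (j = m) - \<theta> j)) = v m - \<mu>"
      using fin m(1) by (simp add: algebra_simps sum_subtractf \<mu>_def)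
    also have "(\<Sum>j\<in>I. (of_bool (j = m) - \<theta> j)\<^sup>2) \<le> (\<Sum>j\<in>I. of_bool (j = m) + \<theta> j)"
    proof (rule sum_mono)
      fix j assume j: "j \<in> I"
      have "\<theta> j * \<theta> j \<le> \<theta> j" using nonneg[OF j] theta_le1[OF j] by (simp add: mult_left_le)
      then show "(of_bool (j = m) - \<theta> j)\<^sup>2 \<le> of_bool (j = m) + \<theta> j"
        using nonneg[OF j] by (auto simp: power2_eq_square algebra_simps)
    qed
    also have "(\<Sum>j\<in>I. of_bool (j = m) + \<theta> j) = 2"
      using fin m(1) sum1 by (simp add: sum.distrib)
    finally have "(\<Sum>j\<in>I. (w j)\<^sup>2) \<le> 2 * real (Suc n)" using m(2) v by simp
    then show "\<exists>w. (\<Sum>j\<in>I. (w j)\<^sup>2) \<le> 2 * real (Suc n) \<and>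
        (\<exists>m\<in>I. \<forall>j\<in>I. w j = v j + of_bool (j = m) - \<theta> j)"
      using m(1) w_def by blast
  qed
  then obtain S where S: "\<And>n. (\<Sum>j\<in>I. (S n j)\<^sup>2) \<le> 2 * real n"
    and step: "\<And>n. \<exists>m\<in>I. \<forall>j\<in>I. S (Suc n) j = S n j + of_bool (j = m) - \<theta> j" by blast
  from step obtain \<sigma> where \<sigma>: "\<And>n. \<sigma> n \<in> I"
    and S_Suc: "\<And>n j. j \<in> I \<Longrightarrow> S (Suc n) j = S n j + of_bool (j = \<sigma> n) - \<theta> j" by metis
  have sq: "(S n j)\<^sup>2 \<le> 2 * real n" if "j \<in> I" for n j
    using member_le_sum[of j I "\<lambda>j. (S n j)\<^sup>2"] S[of n] that fin by simp
  have S_eq: "S n j = (\<Sum>\<tau><n. of_bool (j = \<sigma> \<tau>)) - real n * \<theta> j" if "j \<in> I" for n j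
  proof (induction n)
    case 0
    then show ?case using sq[OF that, of 0] by simp
  next
    case (Suc n)
    then show ?case by (simp add: S_Suc[OF that] algebra_simps del: sum_of_bool_eq)
  qed
  have freq: "(\<lambda>t. (\<Sum>\<tau><t. of_bool (j = \<sigma> \<tau>)) / real t) \<longlonglongrightarrow> \<theta> j" if j: "j \<in> I" for j
  proof -
    have "(\<lambda>t. S t j / real t) \<longlonglongrightarrow> 0"
    proof (rule Lim_null_comparison)
      show "\<forall>\<^sub>F t in sequentially. norm (S t j / real t) \<le> sqrt (2 / real t)"
      proof (rule eventually_mono[OF eventually_gt_at_top[of 0]])
        fix t :: nat assume t: "0 < t"
        have "\<bar>S t j\<bar> \<le> sqrt (2 * real t)"
          using sq[OF j, of t] by (simp add: real_le_rsqrt)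
        then have "\<bar>S t j\<bar> / real t \<le> sqrt (2 * real t) / real t" by (simp add: divide_right_mono)
        also have "\<dots> = sqrt (2 / real t)"
          using t by (simp add: real_sqrt_mult real_sqrt_divide field_simps)
        finally show "norm (S t j / real t) \<le> sqrt (2 / real t)" by simp
      qed
      have "(\<lambda>t. sqrt (2 / real t)) \<longlonglongrightarrow> sqrt 0"
        by (intro tendsto_real_sqrt lim_const_over_n)
      then show "(\<lambda>t. sqrt (2 / real t)) \<longlonglongrightarrow> 0" by simp
    qed
    from tendsto_add[OF this tendsto_const[of "\<theta> j"]]
    have "(\<lambda>t. S t j / real t + \<theta> j) \<longlonglongrightarrow> \<theta> j" by simp
    moreover have "\<forall>\<^sub>F t in sequentially.
        S t j / real t + \<theta> j = (\<Sum>\<tau><t. of_bool (j = \<sigma> \<tau>)) / real t"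
      by (rule eventually_mono[OF eventually_gt_at_top[of 0]])
        (simp add: S_eq[OF j] field_simps)
    ultimately show ?thesis by (simp cong: tendsto_cong)
  qed
  have "(\<lambda>t. (1 / real t) * (\<Sum>\<tau><t. f (\<sigma> \<tau>))) \<longlonglongrightarrow> (\<Sum>j\<in>I. \<theta> j * f j)" for f :: "'i \<Rightarrow> real"
  proof -
    have "f (\<sigma> \<tau>) = (\<Sum>j\<in>I. of_bool (j = \<sigma> \<tau>) * f j)" for \<tau>
      using fin \<sigma>[of \<tau>] by simp
    then have "(\<Sum>\<tau><t. f (\<sigma> \<tau>)) = (\<Sum>j\<in>I. (\<Sum>\<tau><t. of_bool (j = \<sigma> \<tau>)) * f j)" for t
      by (simp only: sum_distrib_right) (rule sum.swap)
    then have "(1 / real t) * (\<Sum>\<tau><t. f (\<sigma> \<tau>))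
        = (\<Sum>j\<in>I. (\<Sum>\<tau><t. of_bool (j = \<sigma> \<tau>)) / real t * f j)" for t
      by (simp only: sum_distrib_left) (simp add: field_simps)
    then show ?thesis by (simp only:) (intro tendsto_intros freq)
  qed
  with \<sigma> show ?thesis by blast
qed

section \<open>Algorithms as mixtures of pure strategies\<close>

definition induced_strategy ::
  "nat \<Rightarrow> (nat \<Rightarrow> 'e set) \<Rightarrow> ('w, 'e, 'a, 'x) algorithm \<Rightarrow> 'x \<Rightarrow> (nat \<Rightarrow> 'e) \<Rightarrow> nat \<Rightarrow> 'a"
where
  "induced_strategy N Om D x = (\<lambda>e\<in>vectors N Om. \<lambda>i\<in>{1..N}. decide D i (e i) x)"

definition strategy_prob ::
  "'w measure \<Rightarrow> nat \<Rightarrow> (nat \<Rightarrow> 'e set) \<Rightarrow> ('w, 'e, 'a, 'x) algorithm \<Rightarrow> nat \<Rightarrow>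
   ((nat \<Rightarrow> 'e) \<Rightarrow> nat \<Rightarrow> 'a) \<Rightarrow> real"
where
  "strategy_prob P N Om D t s =
     measure P {z \<in> space P. induced_strategy N Om D (aux D t z) = s}"

lemma finite_pure_strategies:
  assumes "\<forall>i\<in>{1..N}. finite (Om i)" and "\<forall>i\<in>{1..N}. finite (A i)"
  shows "finite (pure_strategies N Om A)"
  unfolding pure_strategies_def using assms by (intro finite_imageI finite_PiE) auto

lemma induced_strategy_pure:
  assumes "distributed P N Om A \<omega> D" and "x \<in> space (aux_space D)"
  shows "induced_strategy N Om D x \<in> pure_strategies N Om A"
proof -
  define h where "h = (\<lambda>i\<in>{1..N}. \<lambda>y\<in>Om i. decide D i y x)"
  have "decide D i y x \<in> A i" if "i \<in> {1..N}" "y \<in> Om i" for i y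
    using assms that measurable_space[of "decide D i y" "aux_space D" "count_space (A i)"]
    unfolding distributed_def by auto
  then have "h \<in> (\<Pi>\<^sub>E i\<in>{1..N}. Om i \<rightarrow>\<^sub>E A i)" unfolding h_def by auto
  moreover have "induced_strategy N Om D x = (\<lambda>e\<in>vectors N Om. \<lambda>i\<in>{1..N}. h i (e i))"
    unfolding induced_strategy_def h_def by (intro restrict_ext) (auto simp: PiE_mem)
  ultimately show ?thesis unfolding pure_strategies_def by blast
qed

lemma induced_strategy_measurable:
  assumes fin: "\<forall>i\<in>{1..N}. finite (Om i)" and D: "distributed P N Om A \<omega> D"
  shows "{x \<in> space (aux_space D). induced_strategy N Om D x = s} \<in> sets (aux_space D)"
proof (cases "s \<in> pure_strategies N Om A")
  case True
  then obtain h where h: "h \<in> (\<Pi>\<^sub>E i\<in>{1..N}. Om i \<rightarrow>\<^sub>E A i)"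
    and s: "s = (\<lambda>e\<in>vectors N Om. \<lambda>i\<in>{1..N}. h i (e i))"
    unfolding pure_strategies_def by blast
  let ?X = "aux_space D"
  have "(\<forall>e\<in>vectors N Om. \<forall>i\<in>{1..N}. decide D i (e i) x = h i (e i))
        \<longleftrightarrow> induced_strategy N Om D x = s" for x
    unfolding induced_strategy_def s by (auto simp: fun_eq_iff restrict_def)
  moreover have "{x \<in> space ?X. \<forall>e\<in>vectors N Om. \<forall>i\<in>{1..N}. decide D i (e i) x = h i (e i)}
      \<in> sets ?X"
  proof (intro sets.sets_Collect_finite_All)
    show "finite (vectors N Om)" using fin by (intro finite_PiE) auto
    fix e i assume e: "e \<in> vectors N Om" and i: "i \<in> {1..N}"
    have meas: "decide D i (e i) \<in> measurable ?X (count_space (A i))"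
      using D e i unfolding distributed_def by (meson PiE_mem)
    have "h i (e i) \<in> A i" using h e i by (meson PiE_mem)
    then have "decide D i (e i) -` {h i (e i)} \<inter> space ?X \<in> sets ?X"
      by (intro measurable_sets[OF meas]) auto
    then show "{x \<in> space ?X. decide D i (e i) x = h i (e i)} \<in> sets ?X"
      by (simp add: vimage_def Int_def conj_commute)
  qed simp
  ultimately show ?thesis by simp
next
  case False
  then have "{x \<in> space (aux_space D). induced_strategy N Om D x = s} = {}"
    using induced_strategy_pure[OF D] by blast
  then show ?thesis by (simp only: sets.empty_sets)
qed

text \<open>
  Both the event vector and the selected strategy take finitely many values. Splitting the
  expectation over the pairs of values, independence factors the probability of each cell, and the
  sum over the event vectors becomes the penalty of the strategy.
\<close>

lemma
  assumes P: "prob_space P"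
    and Om: "\<forall>i\<in>{1..N}. finite (Om i)"
    and A: "\<forall>i\<in>{1..N}. finite (A i)"
    and iid: "iid_events P N Om \<omega> \<pi>"
    and D: "distributed P N Om A \<omega> D"
  shows strategy_prob_sum: "(\<Sum>s\<in>pure_strategies N Om A. strategy_prob P N Om D t s) = 1"
    and expected_penalty:
      "integral\<^sup>L P (\<lambda>z. ph (action N \<omega> D t z) (\<omega> t z))
       = (\<Sum>s\<in>pure_strategies N Om A. strategy_prob P N Om D t s * strategy_penalty N Om \<pi> ph s)"
proof -
  interpret prob_space P by (rule P)
  let ?G = "pure_strategies N Om A" and ?V = "vectors N Om"
  let ?S = "\<lambda>z. induced_strategy N Om D (aux D t z)"
  have finG: "finite ?G" using Om A by (rule finite_pure_strategies)
  have finV: "finite ?V" using Om by (intro finite_PiE) auto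
  have aux: "aux D t \<in> measurable P (aux_space D)" using D by (simp add: distributed_def)
  have \<omega>: "\<omega> t \<in> measurable P (count_space ?V)"
    using iid unfolding iid_events_def indep_vars_def by blast
  have \<omega>V: "\<omega> t z \<in> ?V" if "z \<in> space P" for z using measurable_space[OF \<omega> that] by simp
  have SG: "?S z \<in> ?G" if "z \<in> space P" for z
    using induced_strategy_pure[OF D measurable_space[OF aux that]] .
  have Sev: "{z \<in> space P. ?S z = s}
      = aux D t -` {x \<in> space (aux_space D). induced_strategy N Om D x = s} \<inter> space P" for s
    using measurable_space[OF aux] by auto
  have \<omega>ev: "{z \<in> space P. \<omega> t z = e} = \<omega> t -` {e} \<inter> space P" for e by auto
  have Smeas: "{z \<in> space P. ?S z = s} \<in> events" for s
    unfolding Sev by (intro measurable_sets[OF aux] induced_strategy_measurable[OF Om D])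
  have \<omega>meas: "{z \<in> space P. \<omega> t z = e} \<in> events" if "e \<in> ?V" for e
    unfolding \<omega>ev using that by (intro measurable_sets[OF \<omega>]) auto
  have cell: "prob ({z \<in> space P. \<omega> t z = e} \<inter> {z \<in> space P. ?S z = s})
      = \<pi> e * strategy_prob P N Om D t s" if e: "e \<in> ?V" for e s
  proof -
    have "indep_set {\<omega> t -` B \<inter> space P | B. B \<in> sets (count_space ?V)}
            {aux D t -` C \<inter> space P | C. C \<in> sets (aux_space D)}"
      using D by (simp add: distributed_def)
    then have "prob ({z \<in> space P. \<omega> t z = e} \<inter> {z \<in> space P. ?S z = s})
        = prob {z \<in> space P. \<omega> t z = e} * prob {z \<in> space P. ?S z = s}"
    proof (rule indep_setD)
      show "{z \<in> space P. \<omega> t z = e} \<in> {\<omega> t -` B \<inter> space P | B. B \<in> sets (count_space ?V)}"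
        unfolding \<omega>ev using e by (intro CollectI exI[of _ "{e}"]) auto
      show "{z \<in> space P. ?S z = s} \<in> {aux D t -` C \<inter> space P | C. C \<in> sets (aux_space D)}"
        unfolding Sev using induced_strategy_measurable[OF Om D] by blast
    qed
    then show ?thesis using iid e unfolding iid_events_def strategy_prob_def by simp
  qed
  have "(\<Sum>s\<in>?G. strategy_prob P N Om D t s) = prob (\<Union>s\<in>?G. {z \<in> space P. ?S z = s})"
    unfolding strategy_prob_def
    by (intro finite_measure_finite_Union[symmetric] finG)
      (use Smeas in \<open>auto simp: disjoint_family_on_def\<close>)
  also have "(\<Union>s\<in>?G. {z \<in> space P. ?S z = s}) = space P" using SG by auto
  finally show "(\<Sum>s\<in>?G. strategy_prob P N Om D t s) = 1" by (simp add: prob_space)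
  have "integral\<^sup>L P (\<lambda>z. ph (action N \<omega> D t z) (\<omega> t z))
      = integral\<^sup>L P (\<lambda>z. \<Sum>s\<in>?G. \<Sum>e\<in>?V. ph (s e) e *
          indicator ({z \<in> space P. \<omega> t z = e} \<inter> {z \<in> space P. ?S z = s}) z)"
  proof (rule Bochner_Integration.integral_cong[OF refl])
    fix z assume z: "z \<in> space P"
    have act: "action N \<omega> D t z = ?S z (\<omega> t z)"
      using \<omega>V[OF z] by (simp add: action_def induced_strategy_def)
    have "(\<Sum>s\<in>?G. \<Sum>e\<in>?V. ph (s e) e *
          indicator ({z \<in> space P. \<omega> t z = e} \<inter> {z \<in> space P. ?S z = s}) z)
        = (\<Sum>s\<in>?G. \<Sum>e\<in>?V. if \<omega> t z = e then (if ?S z = s then ph (s e) e else 0) else 0)"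
      by (intro sum.cong refl) (use z in \<open>auto simp: indicator_def\<close>)
    also have "\<dots> = ph (?S z (\<omega> t z)) (\<omega> t z)"
      using finV finG \<omega>V[OF z] SG[OF z] by simp
    finally show "ph (action N \<omega> D t z) (\<omega> t z) = (\<Sum>s\<in>?G. \<Sum>e\<in>?V. ph (s e) e *
          indicator ({z \<in> space P. \<omega> t z = e} \<inter> {z \<in> space P. ?S z = s}) z)"
      by (simp add: act)
  qed
  also have "\<dots> = (\<Sum>s\<in>?G. \<Sum>e\<in>?V. ph (s e) e *
      prob ({z \<in> space P. \<omega> t z = e} \<inter> {z \<in> space P. ?S z = s}))"
  proof -
    have "has_bochner_integral P
        (\<lambda>z. ph (s e) e * indicator ({z \<in> space P. \<omega> t z = e} \<inter> {z \<in> space P. ?S z = s}) z)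
        (ph (s e) e * prob ({z \<in> space P. \<omega> t z = e} \<inter> {z \<in> space P. ?S z = s}))"
      if "e \<in> ?V" for s e
      using sets.Int[OF \<omega>meas[OF that] Smeas[of s]]
      by (intro has_bochner_integral_mult_right has_bochner_integral_real_indicator emeasure_finite)
        (simp_all add: less_top[symmetric])
    then show ?thesis
      by (intro has_bochner_integral_integral_eq has_bochner_integral_sum)
  qed
  also have "\<dots> = (\<Sum>s\<in>?G. strategy_prob P N Om D t s * strategy_penalty N Om \<pi> ph s)"
    unfolding strategy_penalty_def sum_distrib_left
    by (intro sum.cong refl) (simp add: cell)
  finally show "integral\<^sup>L P (\<lambda>z. ph (action N \<omega> D t z) (\<omega> t z))
      = (\<Sum>s\<in>?G. strategy_prob P N Om D t s * strategy_penalty N Om \<pi> ph s)" .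
qed

text \<open>
  The time average moves into the weights: the same weights serve all penalties \<open>ph\<close>
  simultaneously.
\<close>

lemma avg_penalty_mixture:
  assumes P: "prob_space P"
    and Om: "\<forall>i\<in>{1..N}. finite (Om i)"
    and A: "\<forall>i\<in>{1..N}. finite (A i)"
    and iid: "iid_events P N Om \<omega> \<pi>"
    and D: "distributed P N Om A \<omega> D"
    and g: "bij_betw g {1..L} (pure_strategies N Om A)"
  shows "avg_penalty P N \<omega> ph D t
       = (\<Sum>m=1..L. (1 / real t) * (\<Sum>\<tau><t. strategy_prob P N Om D \<tau> (g m)) *
            strategy_penalty N Om \<pi> ph (g m))"
proof -
  have "integral\<^sup>L P (\<lambda>z. ph (action N \<omega> D \<tau> z) (\<omega> \<tau> z))
      = (\<Sum>m=1..L. strategy_prob P N Om D \<tau> (g m) * strategy_penalty N Om \<pi> ph (g m))" for \<tau>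
    by (subst sum.reindex_bij_betw[OF g]) (rule expected_penalty[OF P Om A iid D])
  then have "avg_penalty P N \<omega> ph D t = (1 / real t) *
      (\<Sum>\<tau><t. \<Sum>m=1..L. strategy_prob P N Om D \<tau> (g m) * strategy_penalty N Om \<pi> ph (g m))"
    unfolding avg_penalty_def by simp
  also have "\<dots> = (\<Sum>m=1..L. (1 / real t) * (\<Sum>\<tau><t. strategy_prob P N Om D \<tau> (g m)) *
            strategy_penalty N Om \<pi> ph (g m))"
    by (subst sum.swap) (simp add: sum_distrib_left sum_distrib_right mult.assoc)
  finally show ?thesis .
qed

section \<open>Comparison with the linear program\<close>

lemma distributed_converse:
  assumes P: "prob_space P"
    and Om: "\<forall>i\<in>{1..N}. finite (Om i)"
    and A: "\<forall>i\<in>{1..N}. finite (A i)"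
    and iid: "iid_events P N Om \<omega> \<pi>"
    and g: "bij_betw g {1..L} (pure_strategies N Om A)"
    and r: "\<And>k m. r k m = strategy_penalty N Om \<pi> (p k) (g m)"
    and D: "D \<in> feasible_algorithms P N Om A \<omega> K p c"
  shows "\<exists>\<theta>\<in>lp_feasible L K r c. ereal (lp_objective L r \<theta>)
           \<le> limsup (\<lambda>t. ereal (avg_penalty P N \<omega> (p 0) D t))"
proof -
  have dist: "distributed P N Om A \<omega> D"
    and lims: "\<And>k. k \<in> {1..K} \<Longrightarrow> limsup (\<lambda>t. ereal (avg_penalty P N \<omega> (p k) D t)) \<le> ereal (c k)"
    using D unfolding feasible_algorithms_def by auto
  \<comment> \<open>Time is shifted by one because the average at time 0 is empty and its weights sum to 0.\<close>
  define \<theta> where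
    "\<theta> t m = (1 / real (t + 1)) * (\<Sum>\<tau><t + 1. strategy_prob P N Om D \<tau> (g m))" for t m
  have avg: "avg_penalty P N \<omega> (p k) D (t + 1) = (\<Sum>m=1..L. \<theta> t m * r k m)" for k t
    unfolding \<theta>_def r by (rule avg_penalty_mixture[OF P Om A iid dist g])
  have shift: "limsup (\<lambda>t. ereal (\<Sum>m=1..L. \<theta> t m * r k m))
      = limsup (\<lambda>t. ereal (avg_penalty P N \<omega> (p k) D t))" for k
    unfolding avg[symmetric] by (rule limsup_shift)
  have "\<exists>\<theta>'\<in>lp_feasible L K r c.
           ereal (lp_objective L r \<theta>') \<le> limsup (\<lambda>t. ereal (lp_objective L r (\<theta> t)))"
  proof (rule lp_limit_point)
    show "\<theta> t m \<ge> 0" for t m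
      unfolding \<theta>_def strategy_prob_def by (intro mult_nonneg_nonneg sum_nonneg) auto
    show "(\<Sum>m=1..L. \<theta> t m) = 1" for t
    proof -
      have one: "(\<Sum>m=1..L. strategy_prob P N Om D \<tau> (g m)) = 1" for \<tau>
        by (subst sum.reindex_bij_betw[OF g]) (rule strategy_prob_sum[OF P Om A iid dist])
      have "(\<Sum>m=1..L. \<theta> t m)
          = (1 / real (t + 1)) * (\<Sum>\<tau><t + 1. \<Sum>m=1..L. strategy_prob P N Om D \<tau> (g m))"
        unfolding \<theta>_def sum_distrib_left[symmetric] by (subst sum.swap) (rule refl)
      also have "\<dots> = 1" unfolding one by simp
      finally show ?thesis .
    qed
    show "limsup (\<lambda>t. ereal (\<Sum>m=1..L. \<theta> t m * r k m)) \<le> ereal (c k)" if "k \<in> {1..K}" for k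
      unfolding shift using lims[OF that] .
  qed
  then show ?thesis unfolding lp_objective_def shift .
qed

text \<open>
  The schedule is common knowledge through \<open>X(t)\<close>. Infinity of the type \<open>'x\<close> provides distinct
  codes for the strategy indices, and a constant random element is independent of \<open>\<omega>(t)\<close> because
  it generates only the events of probability 0 and 1.
\<close>

lemma time_sharing_algorithm:
  fixes P :: "'w measure" and \<sigma> :: "nat \<Rightarrow> nat" and g :: "nat \<Rightarrow> (nat \<Rightarrow> 'e) \<Rightarrow> nat \<Rightarrow> 'a"
  assumes P: "prob_space P"
    and iid: "iid_events P N Om \<omega> \<pi>"
    and inf: "infinite (UNIV :: 'x set)"
    and g: "\<And>m. m \<in> {1..L} \<Longrightarrow> g m \<in> pure_strategies N Om A"
    and \<sigma>: "\<And>t. \<sigma> t \<in> {1..L}"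
  shows "\<exists>D :: ('w, 'e, 'a, 'x) algorithm. distributed P N Om A \<omega> D \<and>
           (\<forall>t z. induced_strategy N Om D (aux D t z) = g (\<sigma> t))"
proof -
  interpret prob_space P by (rule P)
  obtain f :: "nat \<Rightarrow> 'x" where f: "inj f"
    using infinite_countable_subset[OF inf] by blast
  have "\<forall>m\<in>{1..L}. \<exists>h. h \<in> (\<Pi>\<^sub>E i\<in>{1..N}. Om i \<rightarrow>\<^sub>E A i) \<and>
      g m = (\<lambda>e\<in>vectors N Om. \<lambda>i\<in>{1..N}. h i (e i))"
    using g unfolding pure_strategies_def by blast
  from bchoice[OF this] obtain h where
    hm: "\<forall>m\<in>{1..L}. h m \<in> (\<Pi>\<^sub>E i\<in>{1..N}. Om i \<rightarrow>\<^sub>E A i) \<and>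
      g m = (\<lambda>e\<in>vectors N Om. \<lambda>i\<in>{1..N}. h m i (e i))" ..
  have h: "h m \<in> (\<Pi>\<^sub>E i\<in>{1..N}. Om i \<rightarrow>\<^sub>E A i)" if "m \<in> {1..L}" for m
    using bspec[OF hm that] by (rule conjunct1)
  have gh: "g m = (\<lambda>e\<in>vectors N Om. \<lambda>i\<in>{1..N}. h m i (e i))" if "m \<in> {1..L}" for m
    using bspec[OF hm that] by (rule conjunct2)
  define D :: "('w, 'e, 'a, 'x) algorithm" where
    "D = \<lparr>aux_space = count_space (f ` {1..L}), aux = (\<lambda>t z. f (\<sigma> t)),
          decide = (\<lambda>i e x. h (inv f x) i e)\<rparr>"
  have "distributed P N Om A \<omega> D"
    unfolding distributed_def
  proof (intro conjI allI ballI)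
    fix t
    show aux: "aux D t \<in> measurable P (aux_space D)" using \<sigma> by (simp add: D_def)
    have \<omega>: "\<omega> t \<in> measurable P (count_space (vectors N Om))"
      using iid unfolding iid_events_def indep_vars_def by blast
    show "indep_set {\<omega> t -` B \<inter> space P | B. B \<in> sets (count_space (vectors N Om))}
            {aux D t -` C \<inter> space P | C. C \<in> sets (aux_space D)}"
      unfolding indep_sets2_eq
    proof (intro conjI ballI)
      show "{\<omega> t -` B \<inter> space P | B. B \<in> sets (count_space (vectors N Om))} \<subseteq> events"
        using measurable_sets[OF \<omega>] by blast
      show "{aux D t -` C \<inter> space P | C. C \<in> sets (aux_space D)} \<subseteq> events"
        using measurable_sets[OF aux] by blast
      fix a b
      assume a: "a \<in> {\<omega> t -` B \<inter> space P | B. B \<in> sets (count_space (vectors N Om))}"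
        and b: "b \<in> {aux D t -` C \<inter> space P | C. C \<in> sets (aux_space D)}"
      have "a \<subseteq> space P" using a by auto
      moreover have "b = {} \<or> b = space P" using b by (auto simp: D_def split: if_splits)
      ultimately show "prob (a \<inter> b) = prob a * prob b"
        by (auto simp: prob_space Int_absorb2)
    qed
  next
    fix i e assume i: "i \<in> {1..N}" and e: "e \<in> Om i"
    have "h m i e \<in> A i" if "m \<in> {1..L}" for m
      using h[OF that] i e by (meson PiE_mem)
    then show "decide D i e \<in> measurable (aux_space D) (count_space (A i))"
      using f by (auto simp: D_def)
  qed
  moreover have "induced_strategy N Om D (aux D t z) = g (\<sigma> t)" for t z
    using f by (simp add: D_def induced_strategy_def gh[OF \<sigma>])
  ultimately show ?thesis by blast
qed

lemma distributed_achievability: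
  fixes P :: "'w measure" and g :: "nat \<Rightarrow> (nat \<Rightarrow> 'e) \<Rightarrow> nat \<Rightarrow> 'a"
  assumes P: "prob_space P"
    and Om: "\<forall>i\<in>{1..N}. finite (Om i)"
    and A: "\<forall>i\<in>{1..N}. finite (A i)"
    and iid: "iid_events P N Om \<omega> \<pi>"
    and inf: "infinite (UNIV :: 'x set)"
    and g: "bij_betw g {1..L} (pure_strategies N Om A)"
    and r: "\<And>k m. r k m = strategy_penalty N Om \<pi> (p k) (g m)"
    and \<theta>: "\<theta> \<in> lp_feasible L K r c"
  shows "\<exists>D\<in>(feasible_algorithms P N Om A \<omega> K p c :: ('w, 'e, 'a, 'x) algorithm set).
           limsup (\<lambda>t. ereal (avg_penalty P N \<omega> (p 0) D t)) = ereal (lp_objective L r \<theta>)"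
proof -
  interpret prob_space P by (rule P)
  obtain \<sigma> where \<sigma>: "\<And>t. \<sigma> t \<in> {1..L}"
    and conv: "\<And>f. (\<lambda>t. (1 / real t) * (\<Sum>\<tau><t. f (\<sigma> \<tau>))) \<longlonglongrightarrow> (\<Sum>m=1..L. \<theta> m * f m)"
    using time_sharing_sequence[of "{1..L}" \<theta>] \<theta> unfolding lp_feasible_def by auto
  have gG: "\<And>m. m \<in> {1..L} \<Longrightarrow> g m \<in> pure_strategies N Om A"
    using g by (rule bij_betwE[THEN bspec])
  obtain D :: "('w, 'e, 'a, 'x) algorithm" where D: "distributed P N Om A \<omega> D"
    and ind: "\<And>t z. induced_strategy N Om D (aux D t z) = g (\<sigma> t)"
    using time_sharing_algorithm[where ?'x = 'x and g = g and \<sigma> = \<sigma>, OF P iid inf gG \<sigma>]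
    by blast
  have strat: "strategy_prob P N Om D t s = of_bool (s = g (\<sigma> t))" for t s
    unfolding strategy_prob_def ind by (auto simp: prob_space)
  have "integral\<^sup>L P (\<lambda>z. p k (action N \<omega> D t z) (\<omega> t z)) = r k (\<sigma> t)" for k t
    using finite_pure_strategies[OF Om A] gG[OF \<sigma>]
    by (simp add: expected_penalty[OF P Om A iid D] strat r)
  then have "(\<lambda>t. avg_penalty P N \<omega> (p k) D t) \<longlonglongrightarrow> (\<Sum>m=1..L. \<theta> m * r k m)" for k
    unfolding avg_penalty_def using conv[of "r k"] by simp
  then have lim: "limsup (\<lambda>t. ereal (avg_penalty P N \<omega> (p k) D t))
      = ereal (\<Sum>m=1..L. \<theta> m * r k m)" for k
    by (intro lim_imp_Limsup) auto
  have "D \<in> feasible_algorithms P N Om A \<omega> K p c"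
    using D \<theta> by (simp add: feasible_algorithms_def lim lp_feasible_def)
  then show ?thesis using lim[of 0] unfolding lp_objective_def by blast
qed

theorem theorem1:
  fixes P :: "'w measure"
    and N K L :: nat
    and Om :: "nat \<Rightarrow> 'e set"
    and A :: "nat \<Rightarrow> 'a set"
    and \<omega> :: "nat \<Rightarrow> 'w \<Rightarrow> nat \<Rightarrow> 'e"
    and \<pi> :: "(nat \<Rightarrow> 'e) \<Rightarrow> real"
    and p :: "nat \<Rightarrow> (nat \<Rightarrow> 'a) \<Rightarrow> (nat \<Rightarrow> 'e) \<Rightarrow> real"
    and c :: "nat \<Rightarrow> real"
    and g :: "nat \<Rightarrow> (nat \<Rightarrow> 'e) \<Rightarrow> nat \<Rightarrow> 'a"
    and r :: "nat \<Rightarrow> nat \<Rightarrow> real"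
    and algs :: "('w, 'e, 'a, 'x) algorithm set"
    and p0_opt :: ereal
  assumes "prob_space P"
    and "\<And>i. i \<in> {1..N} \<Longrightarrow> finite (Om i) \<and> Om i \<noteq> {}"
    and "\<And>i. i \<in> {1..N} \<Longrightarrow> finite (A i) \<and> A i \<noteq> {}"
    and "iid_events P N Om \<omega> \<pi>"
    and "infinite (UNIV :: 'x set)"
    and "L = num_pure N Om A"
    and "bij_betw g {1..L} (pure_strategies N Om A)"
    and "\<And>k m. r k m = strategy_penalty N Om \<pi> (p k) (g m)"
    and "algs = feasible_algorithms P N Om A \<omega> K p c"
    and "algs \<noteq> {}"
    and "p0_opt = (INF D\<in>algs. limsup (\<lambda>t. ereal (avg_penalty P N \<omega> (p 0) D t)))"
  shows "lp_feasible L K r c \<noteq> {} \<and>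
         lp_value L K r c = p0_opt \<and>
         (\<exists>\<theta>. lp_solution L K r c \<theta> \<and> card {m \<in> {1..L}. \<theta> m > 0} \<le> K + 1)"
proof -
  have Om: "\<forall>i\<in>{1..N}. finite (Om i)" and A: "\<forall>i\<in>{1..N}. finite (A i)"
    using assms(2,3) by auto
  have converse: "\<exists>\<theta>\<in>lp_feasible L K r c. ereal (lp_objective L r \<theta>)
      \<le> limsup (\<lambda>t. ereal (avg_penalty P N \<omega> (p 0) D t))" if "D \<in> algs" for D
    using that unfolding assms(9)
    by (intro distributed_converse[where p = p and r = r, OF assms(1) Om A assms(4,7,8)])
  have achieve: "\<exists>D\<in>algs. limsup (\<lambda>t. ereal (avg_penalty P N \<omega> (p 0) D t))
      = ereal (lp_objective L r \<theta>)" if "\<theta> \<in> lp_feasible L K r c" for \<theta>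
    unfolding assms(9)
    by (rule distributed_achievability[where p = p and r = r, OF assms(1) Om A assms(4,5,7,8) that])
  have nonempty: "lp_feasible L K r c \<noteq> {}" using converse assms(10) by blast
  have "lp_value L K r c = p0_opt"
    unfolding lp_value_def assms(11)
  proof (rule antisym)
    show "(INF \<theta>\<in>lp_feasible L K r c. ereal (lp_objective L r \<theta>))
        \<le> (INF D\<in>algs. limsup (\<lambda>t. ereal (avg_penalty P N \<omega> (p 0) D t)))"
      by (rule INF_mono) (rule converse)
    show "(INF D\<in>algs. limsup (\<lambda>t. ereal (avg_penalty P N \<omega> (p 0) D t)))
        \<le> (INF \<theta>\<in>lp_feasible L K r c. ereal (lp_objective L r \<theta>))"
      by (rule INF_mono) (metis achieve order_refl)
  qed
  moreover obtain \<theta> where \<theta>: "lp_solution L K r c \<theta>"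
    using lp_optimum_exists[OF nonempty] by blast
  then obtain \<theta>' where "\<theta>' \<in> lp_feasible L K r c" "lp_objective L r \<theta>' \<le> lp_objective L r \<theta>"
    "card {m \<in> {1..L}. \<theta>' m > 0} \<le> K + 1"
    using lp_sparse_improvement[of \<theta>] unfolding lp_solution_def by blast
  moreover from this \<theta> have "lp_solution L K r c \<theta>'"
    unfolding lp_solution_def by (meson order_trans)
  ultimately show ?thesis using nonempty by blast
qed

end
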